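(* Let $V\subset X$ be a $p$-dimensional subspace, $n=\dim X$, $0\le q\le n$, and let $W_I$, $I\in\mathcal I_q^n$, be the coordinate $q$-subspaces of an orthogonal basis of $X$. (i) If $p\le q$ then $\displaystyle\sum_{I\in\mathcal I_q^n}\cos^2\Theta_{V,W_I}=\binom{n-p}{n-q}$. (ii) If $p>q$ then $\displaystyle\sum_{I\in\mathcal I_q^n}\cos^2\Theta_{W_I,V}=\binom{p}{q}$.
   Context: $X$ is an $n$-dimensional vector space over $\mathbb{R}$ (real case) or $\mathbb{C}$ (complex case) with inner product $\langle\cdot,\cdot\rangle$ (Hermitian in the complex case, conjugate-linear in the first argument). Blades: a $p$-blade is a simple multivector $\nu=v_1\wedge\cdots\wedge v_p\in\Lambda^pX$; if $\nu\neq0$ it represents the $p$-dimensional subspace $V=\mathrm{span}(v_1,\ldots,v_p)$. Nonzero scalars in $\Lambda^0X$ are $0$-blades representing $\{0\}$. $\Lambda X$ has the inner product given on $p$-blades by $\langle v_1\wedge\cdots\wedge v_p,\,w_1\wedge\cdots\wedge w_p\rangle=\det(\langle v_i,w_j\rangle)$, extended (sesqui)linearly, with distinct grades orthogonal; $\|\nu\|=\sqrt{\langle\nu,\nu\rangle}$. Grassmann angle: for subspaces $V,W\subset X$ (of possibly different dimensions), let $P$ be the orthogonal projection of $X$ onto $W$, acting on blades by $P(v_1\wedge\cdots\wedge v_p)=Pv_1\wedge\cdots\wedge Pv_p$ (identity on scalars). The Grassmann angle $\Theta_{V,W}\in[0,\frac\pi2]$ is defined by $\cos\Theta_{V,W}=\|P\nu\|/\|\nu\|$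 for any nonzero blade $\nu$ representing $V$ (independent of $\nu$). It is not symmetric in general; in particular $\Theta_{\{0\},W}=0$. Multi-indices and coordinate subspaces: for $1\le q\le n$, $\mathcal I_q^n=\{(i_1,\ldots,i_q)\in\mathbb N^q:1\le i_1<\cdots<i_q\le n\}$, and $\mathcal I_0^n=\{0\}$ (a single index). Given a basis $(w_1,\ldots,w_n)$ of $X$, its coordinate $q$-subspaces are $W_I=\mathrm{span}(w_{i_1},\ldots,w_{i_q})$ for $I=(i_1,\ldots,i_q)\in\mathcal I_q^n$; for $q=0$, $W_I=\{0\}$. *)

theory Defs
  imports
    "Jordan_Normal_Form.Determinant"
    "HOL-Library.Poly_Mapping"
    Complex_Main
begin

section \<open>Scalars\<close>

text \<open>The two scalar fields are treated uniformly. A commutative real normed field is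
  isomorphic to \<open>\<real>\<close> or \<open>\<complex>\<close>; the class adds the conjugation and the real part.\<close>

class rc_field = real_normed_field +
  fixes rc_conj :: "'a \<Rightarrow> 'a"
    and rc_re :: "'a \<Rightarrow> real"
  assumes rc_conj_add: "rc_conj (x + y) = rc_conj x + rc_conj y"
    and rc_conj_mult: "rc_conj (x * y) = rc_conj x * rc_conj y"
    and rc_conj_conj: "rc_conj (rc_conj x) = x"
    and rc_conj_mult_self: "rc_conj x * x = (norm x)\<^sup>2 *\<^sub>R 1"
    and rc_re_scaleR_1: "rc_re x *\<^sub>R 1 = (1 / 2) *\<^sub>R (x + rc_conj x)"

instantiation real :: rc_field
begin
definition "rc_conj (x::real) = x"
definition "rc_re (x::real) = x"
instance
  by standard (simp_all add: rc_conj_real_def rc_re_real_def power2_eq_square)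
end

instantiation complex :: rc_field
begin
definition "rc_conj (z::complex) = cnj z"
definition "rc_re (z::complex) = Re z"
instance
proof
  fix x y :: complex
  show "rc_conj x * x = (norm x)\<^sup>2 *\<^sub>R 1"
    using complex_norm_square[of x]
    by (simp add: rc_conj_complex_def scaleR_conv_of_real mult.commute del: of_real_power)
  show "rc_re x *\<^sub>R 1 = (1 / 2) *\<^sub>R (x + rc_conj x)"
    by (simp add: rc_conj_complex_def rc_re_complex_def complex_eq_iff)
qed (simp_all add: rc_conj_complex_def)
end

section \<open>The exterior algebra of a vector space\<close>

text \<open>The vector space freely generated by all lists of vectors is the space
  \<open>'v list \<Rightarrow>\<^sub>0 'k\<close>, with the list \<open>[v\<^sub>1, \<dots>, v\<^sub>p]\<close> standing for the formal product of its
  entries. The exterior algebra is its quotient by the relations saying that the product is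
  multilinear and alternating; a multivector is a coset of these relations. Lists of length
  \<open>p\<close> give the grade \<open>p\<close> part, and the empty list gives the unit scalar.\<close>

definition free_scale :: "'k::field \<Rightarrow> ('b \<Rightarrow>\<^sub>0 'k) \<Rightarrow> ('b \<Rightarrow>\<^sub>0 'k)"
  where "free_scale c f = Poly_Mapping.map (\<lambda>x. c * x) f"

locale exterior = vector_space scale
  for scale :: "'k::field \<Rightarrow> 'v::ab_group_add \<Rightarrow> 'v"
begin

inductive_set ext_relations :: "('v list \<Rightarrow>\<^sub>0 'k) set" where
  add: "Poly_Mapping.single (us @ (x + y) # vs) 1
        - Poly_Mapping.single (us @ x # vs) 1 - Poly_Mapping.single (us @ y # vs) 1
        \<in> ext_relations"
| scale: "Poly_Mapping.single (us @ scale c x # vs) 1 - Poly_Mapping.single (us @ x # vs) c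
        \<in> ext_relations"
| alternating: "Poly_Mapping.single (us @ x # vs @ x # ws) 1 \<in> ext_relations"

definition ext_class :: "('v list \<Rightarrow>\<^sub>0 'k) \<Rightarrow> ('v list \<Rightarrow>\<^sub>0 'k) set"
  where "ext_class f = {g. g - f \<in> module.span free_scale ext_relations}"

definition wedge :: "'v list \<Rightarrow> ('v list \<Rightarrow>\<^sub>0 'k) set"
  where "wedge vs = ext_class (Poly_Mapping.single vs 1)"

definition ext_scalar :: "'k \<Rightarrow> ('v list \<Rightarrow>\<^sub>0 'k) set"
  where "ext_scalar c = ext_class (Poly_Mapping.single [] c)"

definition ext_zero :: "('v list \<Rightarrow>\<^sub>0 'k) set"
  where "ext_zero = ext_class 0"

text \<open>The nonzero blades together with the subspace they represent. Grade 0 is separate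
  because its blades are all scalars, not only the empty product.\<close>

inductive blade_represents :: "('v list \<Rightarrow>\<^sub>0 'k) set \<Rightarrow> 'v set \<Rightarrow> bool" where
  scalar: "c \<noteq> 0 \<Longrightarrow> blade_represents (ext_scalar c) {0}"
| wedge: "vs \<noteq> [] \<Longrightarrow> wedge vs \<noteq> ext_zero \<Longrightarrow> blade_represents (wedge vs) (span (set vs))"

definition free_map :: "('v \<Rightarrow> 'v) \<Rightarrow> ('v list \<Rightarrow>\<^sub>0 'k) \<Rightarrow> ('v list \<Rightarrow>\<^sub>0 'k)"
  where "free_map T f = (\<Sum>vs\<in>Poly_Mapping.keys f. Poly_Mapping.single (map T vs) (Poly_Mapping.lookup f vs))"

text \<open>The map \<open>v\<^sub>1 \<and> \<dots> \<and> v\<^sub>p \<mapsto> T v\<^sub>1 \<and> \<dots> \<and> T v\<^sub>p\<close> induced by a linear \<open>T\<close>, extended linearly.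
  For linear \<open>T\<close> the union is over equal cosets.\<close>

definition ext_map :: "('v \<Rightarrow> 'v) \<Rightarrow> ('v list \<Rightarrow>\<^sub>0 'k) set \<Rightarrow> ('v list \<Rightarrow>\<^sub>0 'k) set"
  where "ext_map T A = (\<Union>f\<in>A. ext_class (free_map T f))"

end

section \<open>Finite-dimensional inner product spaces\<close>

locale inner_product_space = exterior scale
  for scale :: "'k::rc_field \<Rightarrow> 'v::ab_group_add \<Rightarrow> 'v" +
  fixes ip :: "'v \<Rightarrow> 'v \<Rightarrow> 'k"
  assumes ip_add_right: "ip x (y + z) = ip x y + ip x z"
    and ip_scale_right: "ip x (scale c y) = c * ip x y"
    and ip_conj: "ip y x = rc_conj (ip x y)"
    and ip_pos: "x \<noteq> 0 \<Longrightarrow> rc_re (ip x x) > 0"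
    and finite_dimensional: "\<exists>B. finite B \<and> span B = UNIV"
begin

definition gram :: "'v list \<Rightarrow> 'v list \<Rightarrow> 'k"
  where "gram vs ws =
    (if length vs = length ws
     then det (mat (length vs) (length vs) (\<lambda>(i, j). ip (vs ! i) (ws ! j))) else 0)"

definition free_ip :: "('v list \<Rightarrow>\<^sub>0 'k) \<Rightarrow> ('v list \<Rightarrow>\<^sub>0 'k) \<Rightarrow> 'k"
  where "free_ip f g =
    (\<Sum>vs\<in>Poly_Mapping.keys f. \<Sum>ws\<in>Poly_Mapping.keys g. rc_conj (Poly_Mapping.lookup f vs) * Poly_Mapping.lookup g ws * gram vs ws)"

text \<open>The inner product of two multivectors is the common value on their representatives.\<close>

definition ext_ip :: "('v list \<Rightarrow>\<^sub>0 'k) set \<Rightarrow> ('v list \<Rightarrow>\<^sub>0 'k) set \<Rightarrow> 'k"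
  where "ext_ip A B = the_elem (\<Union>f\<in>A. \<Union>g\<in>B. {free_ip f g})"

text \<open>\<open>\<langle>A, A\<rangle>\<close> is a non-negative real scalar; \<open>rc_re\<close> only reads it as a real number.\<close>

definition ext_norm :: "('v list \<Rightarrow>\<^sub>0 'k) set \<Rightarrow> real"
  where "ext_norm A = sqrt (rc_re (ext_ip A A))"

definition orth_proj :: "'v set \<Rightarrow> 'v \<Rightarrow> 'v"
  where "orth_proj W x = (THE w. w \<in> W \<and> (\<forall>y\<in>W. ip y (x - w) = 0))"

text \<open>The quotient does not depend on the nonzero blade \<open>\<nu>\<close> representing \<open>V\<close>, so that the
  description below is met by exactly one angle when \<open>V\<close> and \<open>W\<close> are subspaces.\<close>

definition grassmann_angle :: "'v set \<Rightarrow> 'v set \<Rightarrow> real"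
  where "grassmann_angle V W =
    (THE \<theta>. 0 \<le> \<theta> \<and> \<theta> \<le> pi / 2 \<and>
      (\<forall>\<nu>. blade_represents \<nu> V \<longrightarrow>
        cos \<theta> = ext_norm (ext_map (orth_proj W) \<nu>) / ext_norm \<nu>))"

definition orthogonal_basis :: "nat \<Rightarrow> (nat \<Rightarrow> 'v) \<Rightarrow> bool"
  where "orthogonal_basis n w \<longleftrightarrow>
    inj_on w {1..n} \<and> independent (w ` {1..n}) \<and> span (w ` {1..n}) = UNIV \<and>
    (\<forall>i\<in>{1..n}. \<forall>j\<in>{1..n}. i \<noteq> j \<longrightarrow> ip (w i) (w j) = 0)"

definition coordinate_subspace :: "(nat \<Rightarrow> 'v) \<Rightarrow> nat list \<Rightarrow> 'v set"
  where "coordinate_subspace w I = span (w ` set I)"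

end

text \<open>For \<open>q = 0\<close> the single multi-index is the empty list.\<close>

definition multi_indices :: "nat \<Rightarrow> nat \<Rightarrow> nat list set"
  where "multi_indices n q = {I. length I = q \<and> sorted_wrt (<) I \<and> set I \<subseteq> {1..n}}"

section \<open>Well-definedness of the operations on multivectors\<close>

text \<open>The linear extension of a map \<open>h\<close> on the generators.\<close>

definition free_ext :: "('k::field \<Rightarrow> 'c::ab_group_add \<Rightarrow> 'c) \<Rightarrow> ('b \<Rightarrow> 'c) \<Rightarrow> ('b \<Rightarrow>\<^sub>0 'k) \<Rightarrow> 'c"
  where "free_ext s h f = (\<Sum>x\<in>Poly_Mapping.keys f. s (Poly_Mapping.lookup f x) (h x))"

lemma lookup_free_scale [simp]:
  "Poly_Mapping.lookup (free_scale c f) x = c * Poly_Mapping.lookup f x"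
  unfolding free_scale_def by transfer (simp add: when_def)

lemma vector_space_free_scale: "vector_space (free_scale :: 'k::field \<Rightarrow> ('b \<Rightarrow>\<^sub>0 'k) \<Rightarrow> _)"
  by standard (auto intro!: poly_mapping_eqI simp: lookup_add algebra_simps)

lemma free_ext_superset:
  assumes "vector_space s" "finite S" "Poly_Mapping.keys f \<subseteq> S"
  shows "free_ext s h f = (\<Sum>x\<in>S. s (Poly_Mapping.lookup f x) (h x))"
proof -
  interpret vector_space s by fact
  show ?thesis unfolding free_ext_def
    by (rule sum.mono_neutral_left) (use assms in \<open>auto simp: in_keys_iff\<close>)
qed

lemma linear_free_ext:
  fixes s :: "'k::field \<Rightarrow> 'c::ab_group_add \<Rightarrow> 'c" and h :: "'b \<Rightarrow> 'c"
  assumes "vector_space s"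
  shows "Vector_Spaces.linear free_scale s (free_ext s h)"
proof -
  interpret V: vector_space s by fact
  interpret F: vector_space "free_scale :: 'k \<Rightarrow> ('b \<Rightarrow>\<^sub>0 'k) \<Rightarrow> _" by (rule vector_space_free_scale)
  show ?thesis
  proof (unfold_locales)
    fix f g :: "'b \<Rightarrow>\<^sub>0 'k" and c :: 'k
    let ?S = "Poly_Mapping.keys f \<union> Poly_Mapping.keys g"
    have "Poly_Mapping.keys (f + g) \<subseteq> ?S" by (rule Poly_Mapping.keys_add)
    then show "free_ext s h (f + g) = free_ext s h f + free_ext s h g"
      by (simp add: free_ext_superset[OF assms, of ?S] lookup_add V.scale_left_distrib sum.distrib)
    have "Poly_Mapping.keys (free_scale c f) \<subseteq> Poly_Mapping.keys f" by (auto simp: in_keys_iff)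
    then show "free_ext s h (free_scale c f) = s c (free_ext s h f)"
      by (simp add: free_ext_superset[OF assms, of "Poly_Mapping.keys f"] V.scale_sum_right)
  qed
qed

lemma free_ext_single:
  assumes "vector_space s"
  shows "free_ext s h (Poly_Mapping.single x c) = s c (h x)"
proof -
  interpret V: vector_space s by fact
  show ?thesis by (simp add: free_ext_def)
qed

context exterior
begin

lemma ext_relations_vanish:
  assumes lin: "Vector_Spaces.linear free_scale s L"
    and rel: "\<And>r. r \<in> ext_relations \<Longrightarrow> L r \<in> module.span s N"
    and f: "f \<in> module.span free_scale ext_relations"
  shows "L f \<in> module.span s N"
proof -
  interpret Vector_Spaces.linear free_scale s L by fact
  show ?thesis
    using f
  proof (induction rule: vs1.span_induct_alt)
    case base
    then show ?case by (simp add: vs2.span_zero)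
  next
    case (step c x y)
    then show ?case by (simp add: add scale rel vs2.span_add vs2.span_scale)
  qed
qed

lemma ext_class_eq_iff:
  "ext_class f = ext_class g \<longleftrightarrow> f - g \<in> module.span free_scale ext_relations"
proof -
  interpret F: vector_space "free_scale :: 'k \<Rightarrow> ('v list \<Rightarrow>\<^sub>0 'k) \<Rightarrow> _"
    by (rule vector_space_free_scale)
  have "f - g \<in> F.span ext_relations" if "ext_class f = ext_class g"
  proof -
    have "f \<in> ext_class f" by (simp add: ext_class_def F.span_zero)
    with that show ?thesis by (simp add: ext_class_def)
  qed
  moreover have "ext_class f = ext_class g" if *: "f - g \<in> F.span ext_relations"
  proof -
    have "(x - f \<in> F.span ext_relations) = (x - g \<in> F.span ext_relations)" for x
      using F.span_add_eq2[OF *, of "x - f"] by simp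
    then show ?thesis by (simp add: ext_class_def)
  qed
  ultimately show ?thesis by blast
qed

lemma free_map_conv_free_ext:
  "free_map T = free_ext free_scale (\<lambda>vs. Poly_Mapping.single (map T vs) 1)"
proof -
  have "free_scale c (Poly_Mapping.single xs 1) = Poly_Mapping.single xs c" for c :: 'k and xs :: "'v list"
    by (rule poly_mapping_eqI) (simp add: lookup_single when_def)
  then show ?thesis by (simp add: free_map_def free_ext_def fun_eq_iff)
qed

lemma linear_free_map: "Vector_Spaces.linear free_scale free_scale (free_map T)"
  unfolding free_map_conv_free_ext by (rule linear_free_ext[OF vector_space_free_scale])

lemma free_map_single: "free_map T (Poly_Mapping.single vs c) = Poly_Mapping.single (map T vs) c"
  by (simp add: free_map_def)

lemma ext_map_class:
  assumes T: "Vector_Spaces.linear scale scale T"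
  shows "ext_map T (ext_class f) = ext_class (free_map T f)"
proof -
  interpret T: Vector_Spaces.linear scale scale T by fact
  interpret M: Vector_Spaces.linear free_scale free_scale "free_map T" by (rule linear_free_map)
  have rel: "free_map T r \<in> ext_relations" if "r \<in> ext_relations" for r
    using that
    by cases (simp_all add: free_map_single M.diff T.add T.scale ext_relations.intros)
  have "free_map T x \<in> M.vs1.span ext_relations" if "x \<in> M.vs1.span ext_relations" for x
    by (rule ext_relations_vanish[OF linear_free_map]) (auto intro: M.vs1.span_base rel simp: that)
  then have "ext_class (free_map T g) = ext_class (free_map T f)" if "g \<in> ext_class f" for g
    using that unfolding ext_class_eq_iff by (simp add: ext_class_def M.diff[symmetric])
  moreover have "f \<in> ext_class f" by (simp add: ext_class_def M.vs1.span_zero)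
  ultimately show ?thesis unfolding ext_map_def by blast
qed

lemma ext_map_wedge:
  assumes "Vector_Spaces.linear scale scale T"
  shows "ext_map T (wedge vs) = wedge (map T vs)"
  by (simp add: wedge_def ext_map_class[OF assms] free_map_single)

end

context inner_product_space
begin

lemma rc_conj_0: "rc_conj (0::'k) = 0"
  using rc_conj_add[of "0::'k" 0] by simp

lemma rc_conj_1: "rc_conj (1::'k) = 1"
  using rc_conj_mult_self[of "1::'k"] by simp

lemma comm_ring_hom_rc_conj: "comm_ring_hom (rc_conj :: 'k \<Rightarrow> 'k)"
  by standard (simp_all add: rc_conj_0 rc_conj_1 rc_conj_add rc_conj_mult)

lemma gram_conj: "gram ws vs = rc_conj (gram vs ws)"
proof (cases "length vs = length ws")
  case True
  interpret comm_ring_hom "rc_conj :: 'k \<Rightarrow> 'k" by (rule comm_ring_hom_rc_conj)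
  let ?n = "length ws"
  let ?A = "mat ?n ?n (\<lambda>(i, j). ip (vs ! i) (ws ! j))"
  have "mat ?n ?n (\<lambda>(i, j). ip (ws ! i) (vs ! j)) = (map_mat rc_conj ?A)\<^sup>T"
    by (rule eq_matI) (auto simp: ip_conj[symmetric])
  moreover have "det ((map_mat rc_conj ?A)\<^sup>T) = rc_conj (det ?A)"
    by (subst det_transpose[of _ ?n]) auto
  ultimately show ?thesis using True by (simp add: gram_def)
qed (simp add: gram_def rc_conj_0)

lemma gram_expand_column:
  "\<exists>C. \<forall>z. gram vs (us @ z # zs) = (\<Sum>i<length vs. ip (vs ! i) z * C i)"
proof (cases "length vs = Suc (length us + length zs)")
  case True
  let ?n = "length vs"
  let ?k = "length us"
  let ?M = "\<lambda>z. mat ?n ?n (\<lambda>(i, j). ip (vs ! i) ((us @ z # zs) ! j))"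
  have cof: "cofactor (?M z) i ?k = cofactor (?M 0) i ?k" if "i < ?n" for z i
  proof -
    have nth: "(us @ z # zs) ! j = (us @ 0 # zs) ! j" if "j \<noteq> ?k" for j
      using that by (simp add: nth_append nth_Cons')
    have "mat_delete (?M z) i ?k = mat_delete (?M 0) i ?k"
      using that True nth by (intro eq_matI) (simp_all add: mat_delete_def)
    then show ?thesis by (simp add: cofactor_def)
  qed
  have "gram vs (us @ z # zs) = (\<Sum>i<?n. ip (vs ! i) z * cofactor (?M 0) i ?k)" for z
  proof -
    have "det (?M z) = (\<Sum>i<?n. ?M z $$ (i, ?k) * cofactor (?M z) i ?k)"
      by (rule laplace_expansion_column[of _ ?n]) (use True in auto)
    also have "\<dots> = (\<Sum>i<?n. ip (vs ! i) z * cofactor (?M 0) i ?k)"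
      by (intro sum.cong arg_cong2[of _ _ _ _ "(*)"] cof) (use True in simp_all)
    finally show ?thesis using True by (simp add: gram_def)
  qed
  then show ?thesis
    by (intro exI[of _ "\<lambda>i. cofactor (?M 0) i ?k"] allI)
next
  case False
  then show ?thesis by (intro exI[of _ "\<lambda>_. 0"]) (simp add: gram_def)
qed

lemma gram_add: "gram vs (us @ (x + y) # zs) = gram vs (us @ x # zs) + gram vs (us @ y # zs)"
  using gram_expand_column[of vs us zs] by (auto simp: ip_add_right algebra_simps sum.distrib)

lemma gram_scale: "gram vs (us @ scale c x # zs) = c * gram vs (us @ x # zs)"
  using gram_expand_column[of vs us zs]
  by (auto simp: ip_scale_right algebra_simps sum_distrib_left)

lemma gram_alternating: "gram vs (us @ x # xs @ x # zs) = 0"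
proof (cases "length vs = length (us @ x # xs @ x # zs)")
  case True
  let ?n = "length vs"
  let ?j = "length us + Suc (length xs)"
  have *: "(us @ x # xs @ x # zs) ! ?j = x"
    by (simp add: nth_append)
  have "det (mat ?n ?n (\<lambda>(i, j). ip (vs ! i) ((us @ x # xs @ x # zs) ! j))) = 0"
    by (rule det_identical_columns[of _ ?n "length us" ?j])
      (use True * in \<open>auto intro!: eq_vecI\<close>)
  with True show ?thesis by (simp add: gram_def)
qed (simp add: gram_def)

lemma free_ip_conv_free_ext:
  "free_ip f = free_ext (*) (\<lambda>ws. \<Sum>vs\<in>Poly_Mapping.keys f. rc_conj (Poly_Mapping.lookup f vs) * gram vs ws)"
proof
  fix g
  show "free_ip f g = free_ext (*) (\<lambda>ws. \<Sum>vs\<in>Poly_Mapping.keys f. rc_conj (Poly_Mapping.lookup f vs) * gram vs ws) g"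
    unfolding free_ip_def free_ext_def
    by (subst sum.swap) (simp add: sum_distrib_left mult.assoc mult.left_commute)
qed

lemma vector_space_mult: "vector_space ((*) :: 'k \<Rightarrow> 'k \<Rightarrow> 'k)"
  by standard (simp_all add: algebra_simps)

lemma linear_free_ip: "Vector_Spaces.linear free_scale (*) (free_ip f)"
  unfolding free_ip_conv_free_ext by (rule linear_free_ext[OF vector_space_mult])

lemma free_ip_conj: "free_ip g f = rc_conj (free_ip f g)"
proof -
  interpret comm_ring_hom "rc_conj :: 'k \<Rightarrow> 'k" by (rule comm_ring_hom_rc_conj)
  show ?thesis
    unfolding free_ip_def
    by (subst sum.swap)
      (simp add: hom_sum hom_mult rc_conj_conj gram_conj[symmetric] mult.assoc mult.left_commute)
qed

lemma free_ip_relations: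
  assumes "r \<in> module.span free_scale ext_relations"
  shows "free_ip f r = 0"
proof -
  interpret Vector_Spaces.linear free_scale "(*)" "free_ip f" by (rule linear_free_ip)
  have [simp]: "free_ip f (Poly_Mapping.single ws c)
      = c * (\<Sum>vs\<in>Poly_Mapping.keys f. rc_conj (Poly_Mapping.lookup f vs) * gram vs ws)" for ws c
    unfolding free_ip_conv_free_ext by (rule free_ext_single[OF vector_space_mult])
  have "free_ip f r \<in> vs2.span {}" if "r \<in> ext_relations" for r
    using that
    by cases (auto simp: diff gram_add gram_scale gram_alternating distrib_left
        sum.distrib sum_distrib_left mult.left_commute mult.commute)
  from ext_relations_vanish[OF linear_free_ip this assms] show ?thesis
    by simp
qed

lemma ext_ip_class: "ext_ip (ext_class f) (ext_class g) = free_ip f g"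
proof -
  interpret F: vector_space "free_scale :: 'k \<Rightarrow> ('v list \<Rightarrow>\<^sub>0 'k) \<Rightarrow> _"
    by (rule vector_space_free_scale)
  have right: "free_ip f h = free_ip f g" if "h \<in> ext_class g" for f g h
  proof -
    interpret Vector_Spaces.linear free_scale "(*)" "free_ip f" by (rule linear_free_ip)
    from that have "free_ip f (h - g) = 0" by (intro free_ip_relations) (simp add: ext_class_def)
    then show ?thesis by (simp add: diff)
  qed
  have "free_ip f' g' = free_ip f g" if "f' \<in> ext_class f" "g' \<in> ext_class g" for f' g'
  proof -
    have "free_ip g f' = free_ip g f" by (rule right[OF that(1)])
    then have "free_ip f' g = free_ip f g" by (simp only: free_ip_conj[of _ g])
    with right[OF that(2), of f'] show ?thesis by simp
  qed
  moreover have "f \<in> ext_class f" "g \<in> ext_class g" by (simp_all add: ext_class_def F.span_zero)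
  ultimately have "(\<Union>f'\<in>ext_class f. \<Union>g'\<in>ext_class g. {free_ip f' g'}) = {free_ip f g}"
    by blast
  then show ?thesis by (simp add: ext_ip_def)
qed

lemma ext_ip_wedge: "ext_ip (wedge vs) (wedge ws) = gram vs ws"
  by (simp add: wedge_def ext_ip_class free_ip_def rc_conj_1)

end

end

theory Submission
  imports Defs "HOL-Combinatorics.Multiset_Permutations"
begin

text \<open>If \<open>e\<^sub>1, \<dots>, e\<^sub>p\<close> is an orthonormal basis of \<open>V\<close> and \<open>(b\<^sub>k)\<close>, \<open>k \<in> S\<close>, one of \<open>W\<close>, then
  \<open>cos\<^sup>2 \<Theta>\<^bsub>V,W\<^esub> = det \<langle>e\<^sub>i, P e\<^sub>j\<rangle>\<close>, which by Cauchy--Binet is the sum of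
  \<open>\<bar>\<langle>e\<^sub>1 \<and> \<dots> \<and> e\<^sub>p, b\<^sub>K\<rangle>\<bar>\<^sup>2\<close> over the \<open>p\<close>-subsets \<open>K\<close> of \<open>S\<close>; over a basis of the whole space
  the sum is \<open>1\<close>. In (i) exchange the summations over \<open>I\<close> and \<open>K\<close>: each \<open>K\<close> is contained in
  \<open>(n - p) choose (n - q)\<close> of the \<open>I\<close>. In (ii) summing over \<open>I\<close> first gives \<open>1\<close> for each of the
  \<open>p choose q\<close> subsets of a basis of \<open>V\<close>.\<close>

section \<open>Counting subsets by lists\<close>

text \<open>Grouping the lists by their set of entries, every \<open>q\<close>-subset collects its
  \<open>q!\<close> orderings.\<close>

lemma sum_distinct_lists:
  fixes h :: "'a set \<Rightarrow> real"
  assumes "finite A"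
  shows "(\<Sum>L | set L \<subseteq> A \<and> length L = q \<and> distinct L. h (set L)) =
    fact q * (\<Sum>J | J \<subseteq> A \<and> card J = q. h J)"
proof -
  let ?S = "{L. set L \<subseteq> A \<and> length L = q \<and> distinct L}"
  let ?T = "{J. J \<subseteq> A \<and> card J = q}"
  have "finite ?S" by (rule finite_subset[OF _ finite_lists_length_eq[OF assms, of q]]) auto
  moreover have "finite ?T" using assms by simp
  moreover have "set ` ?S \<subseteq> ?T" by (auto simp: distinct_card)
  ultimately have "(\<Sum>L\<in>?S. h (set L)) = (\<Sum>J\<in>?T. \<Sum>L | L \<in> ?S \<and> set L = J. h (set L))"
    by (rule sum.group[symmetric])
  also have "\<dots> = (\<Sum>J\<in>?T. fact q * h J)"
  proof (rule sum.cong[OF refl])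
    fix J assume J: "J \<in> ?T"
    then have "{L. L \<in> ?S \<and> set L = J} = permutations_of_set J"
      by (auto simp: permutations_of_set_def distinct_card)
    moreover have "finite J" using J assms finite_subset by auto
    moreover have "(\<Sum>L\<in>permutations_of_set J. h (set L)) = (\<Sum>L\<in>permutations_of_set J. h J)"
      by (rule sum.cong) (auto simp: permutations_of_set_def)
    ultimately show "(\<Sum>L | L \<in> ?S \<and> set L = J. h (set L)) = fact q * h J" using J by simp
  qed
  finally show ?thesis by (simp add: sum_distrib_left)
qed

text \<open>A strictly increasing list is determined by its set of entries, so multi-indices can be
  traded for subsets; from here on no ordering has to be tracked.\<close>

lemma sum_multi_indices:
  fixes h :: "nat set \<Rightarrow> real"
  shows "(\<Sum>I\<in>multi_indices n q. h (set I)) = (\<Sum>J | J \<subseteq> {1..n} \<and> card J = q. h J)"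
proof (rule sum.reindex_bij_betw)
  show "bij_betw set (multi_indices n q) {J. J \<subseteq> {1..n} \<and> card J = q}"
  proof (rule bij_betwI[where g = sorted_list_of_set])
    show "set \<in> multi_indices n q \<rightarrow> {J. J \<subseteq> {1..n} \<and> card J = q}"
      by (auto simp: multi_indices_def strict_sorted_iff distinct_card)
    show "sorted_list_of_set \<in> {J. J \<subseteq> {1..n} \<and> card J = q} \<rightarrow> multi_indices n q"
      by (auto simp: multi_indices_def finite_subset[of _ "{1..n}"])
    show "sorted_list_of_set (set I) = I" if "I \<in> multi_indices n q" for I
      using that by (simp add: multi_indices_def strict_sorted_iff sorted_list_of_set.idem_if_sorted_distinct)
    show "set (sorted_list_of_set J) = J" if "J \<in> {J. J \<subseteq> {1..n} \<and> card J = q}" for J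
      using that by (simp add: finite_subset[of _ "{1..n}"])
  qed
qed

text \<open>Complementation in \<open>A\<close> turns the sets containing \<open>D\<close> into
  subsets of \<open>A - D\<close>. The bound on \<open>q\<close> keeps the truncated subtraction
  \<open>card A - q\<close> honest.\<close>

lemma card_supersets:
  assumes A: "finite A" "D \<subseteq> A" "q \<le> card A"
  shows "card {J. J \<subseteq> A \<and> card J = q \<and> D \<subseteq> J} = (card A - card D) choose (card A - q)"
proof -
  have card: "card (A - J) = card A - card J" if "J \<subseteq> A" for J
    using that A(1) by (simp add: card_Diff_subset finite_subset)
  have "bij_betw (\<lambda>J. A - J) {J. J \<subseteq> A \<and> card J = q \<and> D \<subseteq> J} {J. J \<subseteq> A - D \<and> card J = card A - q}"
  proof (rule bij_betwI[where g = "\<lambda>J. A - J"])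
    show "(\<lambda>J. A - J) \<in> {J. J \<subseteq> A - D \<and> card J = card A - q} \<rightarrow> {J. J \<subseteq> A \<and> card J = q \<and> D \<subseteq> J}"
    proof
      fix J assume J: "J \<in> {J. J \<subseteq> A - D \<and> card J = card A - q}"
      then have "J \<subseteq> A" by blast
      with card[of J] J A show "A - J \<in> {J. J \<subseteq> A \<and> card J = q \<and> D \<subseteq> J}" by auto
    qed
  qed (use card in auto)
  then have "card {J. J \<subseteq> A \<and> card J = q \<and> D \<subseteq> J} = card {J. J \<subseteq> A - D \<and> card J = card A - q}"
    by (rule bij_betw_same_card)
  then show ?thesis using A n_subsets[of "A - D" "card A - q"]
    by (simp add: card_Diff_subset finite_subset)
qed

section \<open>Orthonormal families and projections\<close>

context inner_product_space
begin

section \<open>Real scalars and sesquilinearity of the inner product\<close>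

lemma rc_conj_of_real: "rc_conj (of_real r :: 'k) = of_real r"
proof (cases "r = 0")
  case False
  \<comment> \<open>Nothing in the class states outright that conjugation fixes reals; it follows by
    cancelling \<open>of_real r\<close> in the identity for the squared norm.\<close>
  have "rc_conj (of_real r :: 'k) * of_real r = of_real r * of_real r"
    using rc_conj_mult_self[of "of_real r :: 'k"] by (simp add: power2_eq_square scaleR_conv_of_real)
  with False show ?thesis by simp
qed (simp add: rc_conj_0)

lemma rc_re_of_real: "rc_re (of_real r :: 'k) = r"
proof -
  have "(of_real (rc_re (of_real r :: 'k)) :: 'k) = of_real r"
    using rc_re_scaleR_1[of "of_real r :: 'k"]
    by (simp add: rc_conj_of_real scaleR_conv_of_real flip: of_real_add)
  then show ?thesis by (simp only: of_real_eq_iff)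
qed

lemma rc_conj_mult_self': "rc_conj x * x = of_real ((norm x)\<^sup>2)" for x :: 'k
  by (simp add: rc_conj_mult_self scaleR_conv_of_real del: of_real_power)

lemma norm_rc_conj: "norm (rc_conj x) = norm x" for x :: 'k
proof -
  have "(of_real ((norm (rc_conj x))\<^sup>2) :: 'k) = of_real ((norm x)\<^sup>2)"
    unfolding rc_conj_mult_self'[symmetric] rc_conj_conj by (rule mult.commute)
  then show ?thesis by (simp only: of_real_eq_iff) simp
qed

lemma ip_zero_right [simp]: "ip x 0 = 0"
  using ip_scale_right[of x 0 0] by simp

lemma ip_zero_left [simp]: "ip 0 x = 0"
  by (simp add: ip_conj[of 0 x] rc_conj_0)

lemma ip_add_left: "ip (x + y) z = ip x z + ip y z"
  by (simp add: ip_conj[of _ z] ip_add_right rc_conj_add)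

lemma ip_scale_left: "ip (scale c x) y = rc_conj c * ip x y"
  by (simp add: ip_conj[of _ y] ip_scale_right rc_conj_mult)

lemma ip_diff_right: "ip x (y - z) = ip x y - ip x z"
  using ip_add_right[of x "y - z" z] by (simp add: eq_diff_eq)

lemma ip_sum_right: "ip x (sum f A) = (\<Sum>a\<in>A. ip x (f a))"
  by (induction A rule: infinite_finite_induct) (simp_all add: ip_add_right)

lemma ip_sum_left: "ip (sum f A) x = (\<Sum>a\<in>A. ip (f a) x)"
  by (induction A rule: infinite_finite_induct) (simp_all add: ip_add_left)

text \<open>Conjugate symmetry makes \<open>ip x x\<close> its own conjugate, so the average in
  \<open>rc_re_scaleR_1\<close> returns it unchanged.\<close>

lemma ip_self: "ip x x = of_real (rc_re (ip x x))"
  using rc_re_scaleR_1[of "ip x x"]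
  by (simp add: ip_conj[of x x, symmetric] of_real_def)

lemma ip_self_eq_0_iff [simp]: "ip x x = 0 \<longleftrightarrow> x = 0"
  using ip_pos[of x] rc_re_of_real[of 0] by (cases "x = 0") auto

lemma subspace_ip_eq_0: "subspace {y. ip x y = 0}"
  by (auto simp: subspace_def ip_add_right ip_scale_right)

lemma ip_eq_0_span: "(\<And>y. y \<in> S \<Longrightarrow> ip x y = 0) \<Longrightarrow> y \<in> span S \<Longrightarrow> ip x y = 0"
  using span_minimal[OF _ subspace_ip_eq_0, of S x] by blast

text \<open>Families rather than sets: the index type can be basis labels or, through
  \<open>(!)\<close>, the positions of a list.\<close>

definition orthonormal :: "('i \<Rightarrow> 'v) \<Rightarrow> 'i set \<Rightarrow> bool"
  where "orthonormal b S \<longleftrightarrow> (\<forall>i\<in>S. \<forall>j\<in>S. ip (b i) (b j) = (if i = j then 1 else 0))"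

lemma orthonormal_subset: "orthonormal b S \<Longrightarrow> T \<subseteq> S \<Longrightarrow> orthonormal b T"
  unfolding orthonormal_def by blast

lemma orthonormal_ip: "orthonormal b S \<Longrightarrow> i \<in> S \<Longrightarrow> j \<in> S \<Longrightarrow> ip (b i) (b j) = (if i = j then 1 else 0)"
  by (auto simp: orthonormal_def)

text \<open>The explicit expansion stands in for the definite description \<open>orth_proj\<close>,
  so that linearity and self-adjointness become computations with sums.\<close>

definition proj :: "('i \<Rightarrow> 'v) \<Rightarrow> 'i set \<Rightarrow> 'v \<Rightarrow> 'v"
  where "proj b S x = (\<Sum>k\<in>S. scale (ip (b k) x) (b k))"

lemma linear_proj: "Vector_Spaces.linear scale scale (proj b S)"
  by unfold_locales
    (simp_all add: proj_def ip_add_right ip_scale_right scale_left_distrib sum.distrib scale_sum_right)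

lemma proj_in_span: "proj b S x \<in> span (b ` S)"
  unfolding proj_def by (intro span_sum span_scale span_base imageI)

lemma ip_proj_left: "ip (proj b S x) y = ip x (proj b S y)"
  by (simp add: proj_def ip_sum_left ip_sum_right ip_scale_left ip_scale_right ip_conj[symmetric] mult.commute)

lemma proj_basis:
  assumes "orthonormal b S" "finite S" "k \<in> S"
  shows "proj b S (b k) = b k"
proof -
  have "proj b S (b k) = (\<Sum>j\<in>S. if j = k then b k else 0)"
    unfolding proj_def using assms by (intro sum.cong) (auto simp: orthonormal_ip)
  then show ?thesis using assms by simp
qed

text \<open>The fixed points of a linear map form a subspace, and this one contains the vectors of
  the family.\<close>

lemma proj_eq_self:
  assumes "orthonormal b S" "finite S" "x \<in> span (b ` S)"
  shows "proj b S x = x"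
proof -
  interpret P: Vector_Spaces.linear scale scale "proj b S" by (rule linear_proj)
  have "subspace {x. proj b S x = x}"
    by (auto simp: subspace_def P.add P.scale P.zero)
  moreover have "b ` S \<subseteq> {x. proj b S x = x}" using assms proj_basis by auto
  ultimately show ?thesis using span_minimal assms(3) by blast
qed

lemma proj_idem:
  assumes "orthonormal b S" "finite S"
  shows "proj b S (proj b S x) = proj b S x"
  by (rule proj_eq_self[OF assms proj_in_span])

lemma orth_proj_span:
  assumes "orthonormal b S" "finite S"
  shows "orth_proj (span (b ` S)) = proj b S"
proof
  fix x
  have orth: "ip y (x - proj b S x) = 0" if "y \<in> span (b ` S)" for y
    using proj_eq_self[OF assms that] ip_proj_left[of b S y x] by (simp add: ip_diff_right)
  show "orth_proj (span (b ` S)) x = proj b S x"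
    unfolding orth_proj_def
  proof (rule the_equality)
    show "proj b S x \<in> span (b ` S) \<and> (\<forall>y\<in>span (b ` S). ip y (x - proj b S x) = 0)"
      using orth proj_in_span by blast
  next
    fix w assume w: "w \<in> span (b ` S) \<and> (\<forall>y\<in>span (b ` S). ip y (x - w) = 0)"
    \<comment> \<open>Uniqueness: the difference of two candidates lies in the span and is
      orthogonal to the span, hence to itself.\<close>
    let ?d = "w - proj b S x"
    have "?d \<in> span (b ` S)" using w proj_in_span span_diff by blast
    then have "ip ?d (x - proj b S x) - ip ?d (x - w) = 0" using orth w by simp
    then have "ip ?d ?d = 0" by (simp add: ip_diff_right)
    then show "w = proj b S x" by simp
  qed
qed

section \<open>The Cauchy--Binet formula\<close>

lemma gram_eq_det:
  "length vs = p \<Longrightarrow> length ws = p \<Longrightarrow> gram vs ws = det (mat p p (\<lambda>(i, j). ip (vs ! i) (ws ! j)))"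
  by (simp add: gram_def)

text \<open>The Leibniz formula with the permutation acting on the first list, which is the form
  that reappears in \<open>cauchy_binet\<close>.\<close>

lemma gram_eq_sum:
  assumes "length vs = p" "length ws = p"
  shows "gram vs ws = (\<Sum>\<sigma> | \<sigma> permutes {..<p}. of_int (sign \<sigma>) * (\<Prod>j<p. ip (vs ! \<sigma> j) (ws ! j)))"
proof -
  have "gram vs ws = (\<Sum>\<sigma> | \<sigma> permutes {..<p}. of_int (sign \<sigma>) *
      (\<Prod>j<p. mat p p (\<lambda>(i, j). ip (vs ! i) (ws ! j)) $$ (\<sigma> j, j)))"
    unfolding gram_eq_det[OF assms] by (subst det_col[of _ p]) (auto simp: atLeast0LessThan)
  also have "\<dots> = (\<Sum>\<sigma> | \<sigma> permutes {..<p}. of_int (sign \<sigma>) * (\<Prod>j<p. ip (vs ! \<sigma> j) (ws ! j)))"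
  proof (rule sum.cong[OF refl])
    fix \<sigma> assume "\<sigma> \<in> {\<sigma>. \<sigma> permutes {..<p}}"
    then have "\<sigma> j < p" if "j < p" for j using permutes_in_image[of \<sigma> "{..<p}" j] that by simp
    then have "(\<Prod>j<p. mat p p (\<lambda>(i, j). ip (vs ! i) (ws ! j)) $$ (\<sigma> j, j)) = (\<Prod>j<p. ip (vs ! \<sigma> j) (ws ! j))"
      by (intro prod.cong) simp_all
    then show "of_int (sign \<sigma>) * (\<Prod>j<p. mat p p (\<lambda>(i, j). ip (vs ! i) (ws ! j)) $$ (\<sigma> j, j)) =
        of_int (sign \<sigma>) * (\<Prod>j<p. ip (vs ! \<sigma> j) (ws ! j))"
      by simp
  qed
  finally show ?thesis .
qed

lemma gram_permute:
  assumes \<sigma>: "\<sigma> permutes {..<p}" and len: "length vs = p" "length ws = p"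
  shows "gram (permute_list \<sigma> vs) ws = of_int (sign \<sigma>) * gram vs ws"
proof -
  let ?A = "mat p p (\<lambda>(i, j). ip (vs ! i) (ws ! j))"
  have \<sigma>': "\<sigma> permutes {0..<p}" using \<sigma> by (simp add: atLeast0LessThan)
  have "mat p p (\<lambda>(i, j). ip (permute_list \<sigma> vs ! i) (ws ! j)) = mat p p (\<lambda>(i, j). ?A $$ (\<sigma> i, j))"
    using permutes_in_image[OF \<sigma>] \<sigma> len by (intro eq_matI) (auto simp: permute_list_nth)
  then show ?thesis
    using det_permute_rows[OF _ \<sigma>', of ?A] len by (simp add: gram_eq_det[of _ p])
qed

lemma gram_permute_right:
  assumes "\<sigma> permutes {..<p}" "length vs = p" "length ws = p"
  shows "gram vs (permute_list \<sigma> ws) = of_int (sign \<sigma>) * gram vs ws"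
proof -
  \<comment> \<open>The claim is the conjugate of \<open>gram_permute\<close>; the sign survives
    conjugation because it is real.\<close>
  have "(of_int (sign \<sigma>) :: 'k) = of_real (of_int (sign \<sigma>))" by simp
  then have "rc_conj (of_int (sign \<sigma>) :: 'k) = of_int (sign \<sigma>)" by (simp only: rc_conj_of_real)
  then show ?thesis
    using gram_permute[OF assms(1,3,2)] by (simp add: gram_conj[of vs] rc_conj_mult)
qed

lemma gram_not_distinct: "\<not> distinct ws \<Longrightarrow> gram vs ws = 0"
  by (auto dest!: not_distinct_decomp simp: gram_alternating)

lemma gram_sum:
  "finite S \<Longrightarrow> gram vs (us @ (\<Sum>k\<in>S. scale (c k) (b k)) # zs) = (\<Sum>k\<in>S. c k * gram vs (us @ b k # zs))"
proof (induction S rule: finite_induct)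
  case empty
  show ?case using gram_scale[of vs us 0 0 zs] by simp
qed (simp add: gram_add gram_scale)

text \<open>Multilinearity, used for one entry at a time. The prefix \<open>us\<close> is general
  because it gathers the basis vectors already chosen in earlier positions.\<close>

lemma gram_expand_proj:
  assumes "finite S"
  shows "gram vs (us @ map (proj b S) ws) =
    (\<Sum>K | set K \<subseteq> S \<and> length K = length ws.
       (\<Prod>j<length ws. ip (b (K ! j)) (ws ! j)) * gram vs (us @ map b K))"
proof (induction ws arbitrary: us)
  case Nil
  have "{K. set K \<subseteq> S \<and> length K = length []} = {[]}" by auto
  then show ?case by simp
next
  case (Cons y ys)
  let ?L = "\<lambda>m. {K. set K \<subseteq> S \<and> length K = m}"
  let ?g = "\<lambda>k K. (ip (b k) y * (\<Prod>j<length ys. ip (b (K ! j)) (ys ! j))) * gram vs (us @ b k # map b K)"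
  have bij: "bij_betw (\<lambda>(k, K). k # K) (S \<times> ?L (length ys)) (?L (Suc (length ys)))"
  proof (rule bij_betwI[where g = "\<lambda>K. (hd K, tl K)"])
    show "(\<lambda>K. (hd K, tl K)) \<in> ?L (Suc (length ys)) \<rightarrow> S \<times> ?L (length ys)"
      by (auto simp: length_Suc_conv)
  qed (auto simp: length_Suc_conv)
  have "gram vs (us @ map (proj b S) (y # ys)) =
      (\<Sum>k\<in>S. ip (b k) y * gram vs ((us @ [b k]) @ map (proj b S) ys))"
    using gram_sum[OF assms] by (simp add: proj_def)
  also have "\<dots> = (\<Sum>k\<in>S. \<Sum>K\<in>?L (length ys). ?g k K)"
    by (simp only: Cons.IH) (simp add: sum_distrib_left mult.assoc)
  also have "\<dots> = (\<Sum>(k, K)\<in>S \<times> ?L (length ys). ?g k K)"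
    by (rule sum.cartesian_product)
  also have "\<dots> = (\<Sum>K\<in>?L (Suc (length ys)).
      (\<Prod>j<Suc (length ys). ip (b (K ! j)) ((y # ys) ! j)) * gram vs (us @ map b K))"
    unfolding sum.reindex_bij_betw[OF bij, symmetric]
    by (intro sum.cong) (auto simp: prod.lessThan_Suc_shift simp del: prod.lessThan_Suc)
  finally show ?case by simp
qed

text \<open>Summing over all lists instead of the increasing ones counts every subset
  \<open>p!\<close> times, which removes the bookkeeping of sorting permutations.\<close>

lemma cauchy_binet:
  assumes S: "finite S" and len: "length vs = p" "length ws = p"
  shows "fact p * gram vs (map (proj b S) ws) =
    (\<Sum>K | set K \<subseteq> S \<and> length K = p. gram vs (map b K) * gram (map b K) ws)"
proof -
  let ?L = "{K. set K \<subseteq> S \<and> length K = p}"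
  \<comment> \<open>Each permutation reindexes the same sum over lists. Since \<open>gram vs\<close>
    is alternating, the reindexing costs only a sign, and one summand of the Leibniz formula for
    \<open>gram (map b K) ws\<close> appears.\<close>
  have shuffle: "gram vs (map (proj b S) ws) =
      (\<Sum>K\<in>?L. gram vs (map b K) * (of_int (sign \<sigma>) * (\<Prod>j<p. ip (map b K ! \<sigma> j) (ws ! j))))"
    if \<sigma>: "\<sigma> permutes {..<p}" for \<sigma>
  proof -
    have inv: "Hilbert_Choice.inv \<sigma> permutes {..<p}" by (rule permutes_inv[OF \<sigma>])
    have closed: "permute_list \<tau> K \<in> ?L" if "\<tau> permutes {..<p}" "K \<in> ?L" for \<tau> K
      using that by simp
    have cancel: "permute_list \<rho> (permute_list \<tau> K) = K"
      if "\<rho> permutes {..<p}" "\<tau> \<circ> \<rho> = id" "K \<in> ?L" for \<rho> \<tau> K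
      using permute_list_compose[of \<rho> K \<tau>] that by simp
    have bij: "bij_betw (permute_list \<sigma>) ?L ?L"
    proof (rule bij_betwI[where g = "permute_list (Hilbert_Choice.inv \<sigma>)"])
      show "permute_list (Hilbert_Choice.inv \<sigma>) (permute_list \<sigma> K) = K" if "K \<in> ?L" for K
        by (rule cancel[OF inv permutes_inv_o(1)[OF \<sigma>] that])
      show "permute_list \<sigma> (permute_list (Hilbert_Choice.inv \<sigma>) K) = K" if "K \<in> ?L" for K
        by (rule cancel[OF \<sigma> permutes_inv_o(2)[OF \<sigma>] that])
    qed (intro Pi_I closed inv \<sigma>; assumption)+
    have "gram vs (map (proj b S) ws) =
        (\<Sum>K\<in>?L. (\<Prod>j<p. ip (b (K ! j)) (ws ! j)) * gram vs (map b K))"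
      using gram_expand_proj[OF S, of vs "[]" b ws] len by simp
    also have "\<dots> = (\<Sum>K\<in>?L. (\<Prod>j<p. ip (b (permute_list \<sigma> K ! j)) (ws ! j)) * gram vs (map b (permute_list \<sigma> K)))"
      by (rule sum.reindex_bij_betw[OF bij, symmetric])
    also have "\<dots> = (\<Sum>K\<in>?L. gram vs (map b K) * (of_int (sign \<sigma>) * (\<Prod>j<p. ip (map b K ! \<sigma> j) (ws ! j))))"
    proof (rule sum.cong)
      fix K assume K: "K \<in> ?L"
      have "(\<Prod>j<p. ip (b (permute_list \<sigma> K ! j)) (ws ! j)) = (\<Prod>j<p. ip (map b K ! \<sigma> j) (ws ! j))"
        using K \<sigma> permutes_in_image[OF \<sigma>] by (intro prod.cong) (auto simp: permute_list_nth)
      moreover have "gram vs (map b (permute_list \<sigma> K)) = of_int (sign \<sigma>) * gram vs (map b K)"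
        using K \<sigma> len gram_permute_right[OF \<sigma>, of vs "map b K"] by (simp add: permute_list_map)
      ultimately show "(\<Prod>j<p. ip (b (permute_list \<sigma> K ! j)) (ws ! j)) * gram vs (map b (permute_list \<sigma> K))
          = gram vs (map b K) * (of_int (sign \<sigma>) * (\<Prod>j<p. ip (map b K ! \<sigma> j) (ws ! j)))"
        by (simp add: mult_ac)
    qed simp
    finally show ?thesis .
  qed
  \<comment> \<open>Adding up the \<open>p!\<close> versions, one per permutation, completes that
    Leibniz formula for every \<open>K\<close>.\<close>
  have "fact p * gram vs (map (proj b S) ws) = (\<Sum>\<sigma> | \<sigma> permutes {..<p}. gram vs (map (proj b S) ws))"
    by (simp add: card_permutations)
  also have "\<dots> = (\<Sum>\<sigma> | \<sigma> permutes {..<p}. \<Sum>K\<in>?L.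
      gram vs (map b K) * (of_int (sign \<sigma>) * (\<Prod>j<p. ip (map b K ! \<sigma> j) (ws ! j))))"
    by (rule sum.cong[OF refl shuffle]) simp
  also have "\<dots> = (\<Sum>K\<in>?L. gram vs (map b K) * gram (map b K) ws)"
    by (subst sum.swap) (use len in \<open>simp add: gram_eq_sum[of _ p] sum_distrib_left\<close>)
  finally show ?thesis .
qed

text \<open>For equal lists the two factors in \<open>cauchy_binet\<close> are conjugate, so each
  product is a squared norm. In particular the value is real.\<close>

lemma gram_proj_self:
  assumes "finite S" "length vs = p"
  shows "gram vs (map (proj b S) vs) =
    of_real ((\<Sum>K | set K \<subseteq> S \<and> length K = p. (norm (gram vs (map b K)))\<^sup>2) / fact p)"
proof -
  have "gram vs (map b K) * gram (map b K) vs = of_real ((norm (gram vs (map b K)))\<^sup>2)" for K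
    by (simp add: gram_conj[of _ vs] rc_conj_mult_self'[symmetric] mult.commute del: of_real_power)
  then have "fact p * gram vs (map (proj b S) vs) =
      of_real (\<Sum>K | set K \<subseteq> S \<and> length K = p. (norm (gram vs (map b K)))\<^sup>2)"
    using cauchy_binet[OF assms(1,2,2), of b] by simp
  then show ?thesis by (simp add: field_simps)
qed

text \<open>In each matrix entry self-adjointness moves one projection across and idempotence
  absorbs it.\<close>

lemma gram_proj_proj:
  assumes "orthonormal b S" "finite S"
  shows "gram (map (proj b S) vs) (map (proj b S) ws) = gram vs (map (proj b S) ws)"
proof (cases "length vs = length ws")
  case True
  then show ?thesis
    by (auto simp: gram_def ip_proj_left proj_idem[OF assms] intro!: arg_cong[of _ _ det] cong_mat)
qed (simp add: gram_def)

lemma gram_proj_left: "gram (map (proj b S) vs) ws = gram vs (map (proj b S) ws)"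
proof (cases "length vs = length ws")
  case True
  then have "mat (length ws) (length ws) (\<lambda>(i, j). ip (map (proj b S) vs ! i) (ws ! j)) =
      mat (length ws) (length ws) (\<lambda>(i, j). ip (vs ! i) (map (proj b S) ws ! j))"
    by (intro eq_matI) (auto simp: ip_proj_left)
  with True show ?thesis by (simp add: gram_def)
qed (simp add: gram_def)

section \<open>Blades and the Grassmann angle\<close>

text \<open>Coefficients belong to positions, not to vectors: repetitions in \<open>vs\<close> do no
  harm, and the coefficients can fill a matrix.\<close>

lemma in_span_set_list:
  assumes "x \<in> span (set vs)"
  shows "\<exists>c. x = (\<Sum>i<length vs. scale (c i) (vs ! i))"
  using assms
proof (induction rule: span_induct_alt)
  case base
  show ?case by (intro exI[of _ "\<lambda>_. 0"]) simp
next
  case (step a x y)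
  then obtain k c where k: "k < length vs" "x = vs ! k" and y: "y = (\<Sum>i<length vs. scale (c i) (vs ! i))"
    by (auto simp: in_set_conv_nth)
  have "scale a x = (\<Sum>i<length vs. if i = k then scale a (vs ! i) else 0)" using k by simp
  also have "\<dots> = (\<Sum>i<length vs. scale (if i = k then a else 0) (vs ! i))"
    by (rule sum.cong) auto
  finally have "scale a x + y = (\<Sum>i<length vs. scale ((if i = k then a else 0) + c i) (vs ! i))"
    unfolding y by (simp only: scale_left_distrib sum.distrib)
  then show ?case by (intro exI)
qed

section \<open>Vanishing and non-vanishing of wedge products\<close>

lemma wedge_eq_zero_iff:
  "wedge vs = ext_zero \<longleftrightarrow> Poly_Mapping.single vs 1 \<in> module.span free_scale ext_relations"
  by (simp add: wedge_def ext_zero_def ext_class_eq_iff)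

text \<open>The vectors that make the product vanish in the given slot form a subspace by the
  additivity and scaling relations, and the alternating relation puts all other entries into
  it.\<close>

lemma wedge_in_span_eq_zero:
  assumes "x \<in> span (set us \<union> set zs)"
  shows "wedge (us @ x # zs) = ext_zero"
proof -
  interpret F: vector_space "free_scale :: 'k \<Rightarrow> ('v list \<Rightarrow>\<^sub>0 'k) \<Rightarrow> _"
    by (rule vector_space_free_scale)
  let ?s = "\<lambda>x. Poly_Mapping.single (us @ x # zs) (1::'k)"
  let ?N = "{x. ?s x \<in> F.span ext_relations}"
  have "subspace ?N"
    unfolding subspace_def
  proof (intro conjI ballI allI)
    \<comment> \<open>The scaling relation with factor 0: its second term is the zero
      element.\<close>
    show "0 \<in> ?N"
      using F.span_base[OF ext_relations.scale[of us 0 0 zs]] by simp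
  next
    fix x y assume "x \<in> ?N" "y \<in> ?N"
    then have "(?s (x + y) - ?s x - ?s y) + (?s x + ?s y) \<in> F.span ext_relations"
      by (intro F.span_add F.span_base[OF ext_relations.add]) simp_all
    then show "x + y \<in> ?N" by simp
  next
    fix c x assume "x \<in> ?N"
    moreover have "free_scale c (?s x) = Poly_Mapping.single (us @ x # zs) c"
      by (rule poly_mapping_eqI) (simp add: lookup_single when_def)
    ultimately have "(?s (scale c x) - Poly_Mapping.single (us @ x # zs) c)
        + Poly_Mapping.single (us @ x # zs) c \<in> F.span ext_relations"
      using F.span_scale[of "?s x" ext_relations c]
      by (intro F.span_add F.span_base[OF ext_relations.scale]) simp
    then show "scale c x \<in> ?N" by simp
  qed
  moreover have "set us \<union> set zs \<subseteq> ?N"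
  proof
    fix x assume "x \<in> set us \<union> set zs"
    then have "?s x \<in> ext_relations"
    proof
      assume "x \<in> set us"
      then obtain as bs where "us = as @ x # bs" by (auto dest: split_list)
      then show ?thesis using ext_relations.alternating[of as x bs zs] by simp
    next
      assume "x \<in> set zs"
      then obtain as bs where "zs = as @ x # bs" by (auto dest: split_list)
      then show ?thesis using ext_relations.alternating[of us x as bs] by simp
    qed
    then show "x \<in> ?N" by (simp add: F.span_base)
  qed
  ultimately have "span (set us \<union> set zs) \<subseteq> ?N" by (intro span_minimal)
  with assms show ?thesis by (auto simp: wedge_eq_zero_iff)
qed

text \<open>In a repeated or dependent list some entry lies in the span of the others, which kills
  the product. Hence the subspace determines the grade of its blades.\<close>

lemma length_eq_dim_if_wedge_nonzero:
  assumes "wedge vs \<noteq> ext_zero"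
  shows "length vs = dim (span (set vs))"
proof -
  have "distinct vs"
  proof (rule ccontr)
    assume "\<not> distinct vs"
    then obtain us y xs zs where "vs = us @ y # (xs @ y # zs)" using not_distinct_decomp by fastforce
    then show False using assms wedge_in_span_eq_zero[of y us "xs @ y # zs"] by (simp add: span_base)
  qed
  moreover have "independent (set vs)"
  proof
    assume "dependent (set vs)"
    then obtain a where a: "a \<in> set vs" "a \<in> span (set vs - {a})" by (auto simp: dependent_def)
    then obtain us zs where vs: "vs = us @ a # zs" by (auto dest: split_list)
    \<comment> \<open>Distinctness guarantees that no second copy of \<open>a\<close> is left in
      \<open>us\<close> or \<open>zs\<close>.\<close>
    with \<open>distinct vs\<close> have "set vs - {a} = set us \<union> set zs" by auto
    with a vs assms wedge_in_span_eq_zero show False by simp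
  qed
  ultimately show ?thesis by (simp add: dim_eq_card_independent distinct_card)
qed

text \<open>The inner product is well defined on cosets and vanishes on the zero coset, so it
  certifies that a product survives in the quotient.\<close>

lemma wedge_nonzero: "gram vs vs \<noteq> 0 \<Longrightarrow> wedge vs \<noteq> ext_zero"
  using ext_ip_wedge[of vs vs] by (auto simp: ext_zero_def ext_ip_class free_ip_def)

lemma ext_norm_wedge: "ext_norm (wedge vs) = sqrt (rc_re (gram vs vs))"
  by (simp add: ext_norm_def ext_ip_wedge)

section \<open>Gram determinants against an orthonormal list\<close>

definition orthonormal_list :: "'v list \<Rightarrow> bool"
  where "orthonormal_list es \<longleftrightarrow> orthonormal ((!) es) {..<length es}"

lemma orthonormal_list_map:
  assumes "orthonormal b S" "set K \<subseteq> S" "distinct K"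
  shows "orthonormal_list (map b K)"
  unfolding orthonormal_list_def orthonormal_def
proof (intro ballI)
  fix i j assume "i \<in> {..<length (map b K)}" "j \<in> {..<length (map b K)}"
  moreover from this have "K ! i \<in> S" "K ! j \<in> S" using assms(2) by auto
  ultimately show "ip (map b K ! i) (map b K ! j) = (if i = j then 1 else 0)"
    using assms by (simp add: orthonormal_ip nth_eq_iff_index_eq)
qed

lemma gram_orthonormal_list:
  assumes "orthonormal_list es"
  shows "gram es es = 1"
proof -
  have "mat (length es) (length es) (\<lambda>(i, j). ip (es ! i) (es ! j)) = 1\<^sub>m (length es)"
    using assms by (intro eq_matI) (auto simp: orthonormal_list_def orthonormal_ip)
  then show ?thesis by (simp add: gram_def)
qed

text \<open>Expanding \<open>vs\<close> in \<open>es\<close> factors the Gram matrix. This expresses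
  that the top exterior power of a subspace is a line: the blade of \<open>vs\<close> is
  \<open>gram es vs\<close> times that of \<open>es\<close>.\<close>

lemma gram_factor:
  assumes es: "orthonormal_list es" and len: "length es = p" "length xs = p" "length vs = p"
    and span: "set vs \<subseteq> span (set es)"
  shows "gram xs vs = gram xs es * gram es vs"
proof -
  let ?A = "mat p p (\<lambda>(i, j). ip (xs ! i) (es ! j))"
  let ?B = "mat p p (\<lambda>(i, j). ip (es ! i) (vs ! j))"
  have "(!) es ` {..<length es} = set es" by (auto simp: set_conv_nth)
  then have expand: "vs ! j = proj ((!) es) {..<p} (vs ! j)" if "j < p" for j
    using proj_eq_self[of "(!) es" "{..<p}" "vs ! j"] es span len that
    by (auto simp: orthonormal_list_def subset_iff)
  have "mat p p (\<lambda>(i, j). ip (xs ! i) (vs ! j)) = ?A * ?B"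
  proof (rule eq_matI)
    fix i j assume "i < dim_row (?A * ?B)" "j < dim_col (?A * ?B)"
    then have ij: "i < p" "j < p" by simp_all
    have "ip (xs ! i) (vs ! j) = (\<Sum>k<p. ip (xs ! i) (es ! k) * ip (es ! k) (vs ! j))"
      by (subst expand[OF ij(2)]) (simp add: proj_def ip_sum_right ip_scale_right mult.commute)
    then show "mat p p (\<lambda>(i, j). ip (xs ! i) (vs ! j)) $$ (i, j) = (?A * ?B) $$ (i, j)"
      using ij by (simp add: scalar_prod_def atLeast0LessThan)
  qed simp_all
  then show ?thesis using len by (simp add: gram_eq_det[of _ p] det_mult[of _ p])
qed

text \<open>Writing \<open>es\<close> in terms of \<open>vs\<close> exhibits
  \<open>gram es vs\<close> as a factor of \<open>gram es es\<close>, which is 1.\<close>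

lemma gram_nonzero_if_span:
  assumes es: "orthonormal_list es" and len: "length es = p" "length vs = p"
    and span: "set es \<subseteq> span (set vs)"
  shows "gram es vs \<noteq> 0"
proof -
  have "\<forall>j<p. \<exists>c. es ! j = (\<Sum>k<p. scale (c k) (vs ! k))"
    using in_span_set_list[of _ vs] span len by (auto simp: subset_iff)
  then obtain c where c: "\<And>j. j < p \<Longrightarrow> es ! j = (\<Sum>k<p. scale (c j k) (vs ! k))" by metis
  let ?A = "mat p p (\<lambda>(i, j). ip (es ! i) (vs ! j))"
  let ?C = "mat p p (\<lambda>(k, j). c j k)"
  have "mat p p (\<lambda>(i, j). ip (es ! i) (es ! j)) = ?A * ?C"
  proof (rule eq_matI)
    fix i j assume "i < dim_row (?A * ?C)" "j < dim_col (?A * ?C)"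
    then have ij: "i < p" "j < p" by simp_all
    have "ip (es ! i) (es ! j) = (\<Sum>k<p. ip (es ! i) (vs ! k) * c j k)"
      by (subst c[OF ij(2)]) (simp add: ip_sum_right ip_scale_right mult.commute)
    then show "mat p p (\<lambda>(i, j). ip (es ! i) (es ! j)) $$ (i, j) = (?A * ?C) $$ (i, j)"
      using ij by (simp add: scalar_prod_def atLeast0LessThan)
  qed simp_all
  then have "1 = gram es vs * det ?C"
    using gram_orthonormal_list[OF es] len by (simp add: gram_eq_det[of _ p] det_mult[of _ p])
  then show ?thesis by auto
qed

text \<open>Replacing the blade of \<open>es\<close> by another blade of the same subspace
  multiplies both norms by the same positive factor, so the quotient can be computed on
  \<open>es\<close>.\<close>

lemma blade_proj_ratio:
  assumes es: "orthonormal_list es" "span (set es) = V"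
    and b: "orthonormal b S" "finite S"
    and r: "gram es (map (proj b S) es) = of_real r"
    and \<nu>: "blade_represents \<nu> V"
  shows "ext_norm (ext_map (proj b S) \<nu>) / ext_norm \<nu> = sqrt r"
proof -
  have dim: "length es = dim V"
    using length_eq_dim_if_wedge_nonzero[of es] wedge_nonzero[of es] gram_orthonormal_list[OF es(1)] es(2)
    by simp
  show ?thesis
    using \<nu>
  proof cases
    case (scalar c)
    \<comment> \<open>Here \<open>es\<close> is empty and the empty determinant is 1, which forces
      \<open>r = 1\<close>.\<close>
    have "dim {0} = 0" using dim_span_eq_card_independent[OF independent_empty] by simp
    with dim scalar have "es = []" by simp
    with r have "(of_real r :: 'k) = of_real 1" by (simp add: gram_def)
    then have "r = 1" by (simp only: of_real_eq_iff)
    moreover have "ext_map (proj b S) \<nu> = \<nu>"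
      unfolding scalar ext_scalar_def by (simp add: ext_map_class[OF linear_proj] free_map_single)
    moreover have "free_ip (Poly_Mapping.single [] c) (Poly_Mapping.single [] c) = of_real ((norm c)\<^sup>2)"
      using scalar by (simp add: free_ip_def gram_def rc_conj_mult_self' del: of_real_power)
    then have "ext_norm \<nu> = norm c"
      unfolding scalar ext_norm_def ext_scalar_def by (simp only: ext_ip_class rc_re_of_real) simp
    ultimately show ?thesis using scalar by simp
  next
    case (wedge vs)
    let ?g = "gram es vs"
    have len: "length vs = length es"
      using length_eq_dim_if_wedge_nonzero wedge dim by simp
    have sub: "set vs \<subseteq> span (set es)" "set es \<subseteq> span (set vs)"
      using wedge es(2) span_superset by blast+
    have factor: "gram xs vs = gram xs es * ?g" if "length xs = length es" for xs
      using gram_factor[OF es(1) refl that len sub(1)] .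
    have norm_g: "rc_conj ?g * ?g = of_real ((norm ?g)\<^sup>2)" by (rule rc_conj_mult_self')
    have vs: "gram vs vs = of_real ((norm ?g)\<^sup>2)"
      using factor[OF len] norm_g by (simp add: gram_conj[of vs es])
    have "gram (map (proj b S) es) es = of_real r" by (simp add: gram_proj_left r)
    \<comment> \<open>\<open>factor\<close> handles only the right argument. It is applied to the
      projected \<open>es\<close>, the result is conjugated, and it is applied again to the
      projected \<open>vs\<close>; the two occurrences of \<open>?g\<close> combine to its squared
      norm.\<close>
    then have "gram vs (map (proj b S) es) = of_real r * rc_conj ?g"
      using factor[of "map (proj b S) es"]
      by (simp add: gram_conj[of vs] rc_conj_mult rc_conj_of_real)
    then have "gram (map (proj b S) vs) vs = of_real r * of_real ((norm ?g)\<^sup>2)"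
      using factor[of "map (proj b S) vs"] len norm_g by (simp add: gram_proj_left mult.assoc)
    then have "gram (map (proj b S) vs) (map (proj b S) vs) = of_real (r * (norm ?g)\<^sup>2)"
      unfolding gram_proj_proj[OF b] by (simp only: gram_proj_left of_real_mult)
    then have "ext_norm (ext_map (proj b S) \<nu>) = sqrt r * norm ?g"
      unfolding wedge ext_map_wedge[OF linear_proj] ext_norm_wedge
      by (simp only: rc_re_of_real) (simp add: real_sqrt_mult)
    moreover have "ext_norm \<nu> = norm ?g"
      unfolding wedge ext_norm_wedge vs rc_re_of_real by simp
    moreover have "?g \<noteq> 0" using gram_nonzero_if_span[OF es(1) refl len sub(2)] .
    ultimately show ?thesis by simp
  qed
qed

text \<open>Without a blade the condition in \<open>grassmann_angle\<close> would be vacuous and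
  would not single out an angle.\<close>

lemma blade_represents_orthonormal_list:
  assumes "orthonormal_list es"
  shows "\<exists>\<nu>. blade_represents \<nu> (span (set es))"
proof (cases "es = []")
  case True
  then show ?thesis using blade_represents.scalar[of 1] by (auto simp del: One_nat_def)
next
  case False
  then show ?thesis
    using blade_represents.wedge[of es] wedge_nonzero[of es] gram_orthonormal_list[OF assms] by auto
qed

text \<open>Parseval's identity in the exterior power: projecting onto the whole space changes
  nothing, so \<open>gram_proj_self\<close> evaluates \<open>gram es es = 1\<close>.\<close>

lemma sum_norm_gram_basis:
  assumes b: "orthonormal b B" "finite B" "span (b ` B) = UNIV" and es: "orthonormal_list es"
  shows "(\<Sum>K | set K \<subseteq> B \<and> length K = length es. (norm (gram es (map b K)))\<^sup>2) = fact (length es)"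
proof -
  let ?s = "\<Sum>K | set K \<subseteq> B \<and> length K = length es. (norm (gram es (map b K)))\<^sup>2"
  have "map (proj b B) es = es" using proj_eq_self[OF b(1,2)] b(3) by (simp add: map_idI)
  then have "of_real (?s / fact (length es)) = (of_real 1 :: 'k)"
    using gram_proj_self[OF b(2) refl, of es b] gram_orthonormal_list[OF es] by simp
  then have "?s / fact (length es) = 1" by (simp only: of_real_eq_iff)
  then show ?thesis by simp
qed

text \<open>The quotient of norms is the same for all blades and lies between 0 and 1, so its
  \<open>arccos\<close> is the one angle that fits the description.\<close>

lemma cos_grassmann_angle:
  assumes b: "orthonormal b B" "finite B" "span (b ` B) = UNIV" and S: "S \<subseteq> B"
    and es: "orthonormal_list es"
  shows "(cos (grassmann_angle (span (set es)) (span (b ` S))))\<^sup>2 =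
    (\<Sum>K | set K \<subseteq> S \<and> length K = length es. (norm (gram es (map b K)))\<^sup>2) / fact (length es)"
proof -
  let ?sum = "\<lambda>S. \<Sum>K | set K \<subseteq> S \<and> length K = length es. (norm (gram es (map b K)))\<^sup>2"
  define r where "r = ?sum S / fact (length es)"
  have bS: "orthonormal b S" "finite S"
    using b S orthonormal_subset finite_subset by blast+
  \<comment> \<open>The surrounding basis supplies the upper bound 1: the sum for \<open>S\<close>
    is part of the sum for \<open>B\<close>.\<close>
  have "?sum S \<le> ?sum B"
    using S b(2) by (intro sum_mono2 finite_lists_length_eq) auto
  then have r: "0 \<le> r" "r \<le> 1"
    by (simp_all add: r_def sum_nonneg sum_norm_gram_basis[OF b es])
  have ratio: "ext_norm (ext_map (orth_proj (span (b ` S))) \<nu>) / ext_norm \<nu> = sqrt r"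
    if "blade_represents \<nu> (span (set es))" for \<nu>
    unfolding orth_proj_span[OF bS] r_def
    by (rule blade_proj_ratio[OF es refl bS gram_proj_self[OF bS(2) refl] that])
  have "grassmann_angle (span (set es)) (span (b ` S)) = arccos (sqrt r)"
    unfolding grassmann_angle_def
  proof (rule the_equality)
    have "0 \<le> arccos (sqrt r)" "arccos (sqrt r) \<le> pi / 2"
      using r arccos_le_pi2[of "sqrt r"] arccos_lbound[of "sqrt r"] order_trans[of "- 1" 0 "sqrt r"]
      by simp_all
    then show "0 \<le> arccos (sqrt r) \<and> arccos (sqrt r) \<le> pi / 2 \<and>
      (\<forall>\<nu>. blade_represents \<nu> (span (set es)) \<longrightarrow>
        cos (arccos (sqrt r)) = ext_norm (ext_map (orth_proj (span (b ` S))) \<nu>) / ext_norm \<nu>)"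
      using r ratio by (simp add: cos_arccos_abs)
  next
    fix \<theta>
    assume \<theta>: "0 \<le> \<theta> \<and> \<theta> \<le> pi / 2 \<and> (\<forall>\<nu>. blade_represents \<nu> (span (set es)) \<longrightarrow>
      cos \<theta> = ext_norm (ext_map (orth_proj (span (b ` S))) \<nu>) / ext_norm \<nu>)"
    then have "cos \<theta> = sqrt r" using blade_represents_orthonormal_list[OF es] ratio by force
    then show "\<theta> = arccos (sqrt r)" using \<theta> arccos_cos[of \<theta>] by simp
  qed
  then show ?thesis using r by (simp add: cos_arccos_abs r_def)
qed

section \<open>Orthonormal bases\<close>

lemma independent_orthonormal:
  assumes "orthonormal b S"
  shows "inj_on b S" "independent (b ` S)"
proof -
  show "inj_on b S"
  proof (rule inj_onI)
    fix i j assume "i \<in> S" "j \<in> S" "b i = b j"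
    then show "i = j"
      using orthonormal_ip[OF assms, of i i] orthonormal_ip[OF assms, of i j] by (auto split: if_splits)
  qed
  show "independent (b ` S)"
  proof
    assume "dependent (b ` S)"
    then obtain k where k: "k \<in> S" "b k \<in> span (b ` S - {b k})" by (auto simp: dependent_def)
    have "ip (b k) y = 0" if "y \<in> b ` S - {b k}" for y
      using that k(1) assms by (auto simp: orthonormal_ip)
    then have "ip (b k) (b k) = 0" by (rule ip_eq_0_span[OF _ k(2)])
    then show False using assms k(1) by (simp add: orthonormal_ip)
  qed
qed

lemma ex_normalize:
  assumes "y \<noteq> 0"
  shows "\<exists>c. c \<noteq> 0 \<and> ip (scale c y) (scale c y) = 1"
proof -
  let ?R = "rc_re (ip y y)"
  let ?c = "of_real (1 / sqrt ?R) :: 'k"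
  have R: "?R > 0" by (rule ip_pos[OF assms])
  have "ip (scale ?c y) (scale ?c y) = ?c * (?c * of_real ?R)"
    by (simp only: ip_scale_left ip_scale_right rc_conj_of_real ip_self[of y, symmetric])
  also have "\<dots> = of_real (1 / sqrt ?R * (1 / sqrt ?R * ?R))" by (simp only: of_real_mult)
  also have "\<dots> = 1" using R by simp
  finally show ?thesis using R by (intro exI[of _ ?c]) simp
qed

text \<open>Gram-Schmidt in extremal form: a longest orthonormal extension inside \<open>V\<close>
  exists because independence bounds its length by the size of a finite spanning set, and maximality
  makes it span \<open>V\<close>.\<close>

lemma orthonormal_extend:
  fixes e :: "nat \<Rightarrow> 'v"
  assumes e: "orthonormal e {..<m}" "e ` {..<m} \<subseteq> V" and V: "subspace V"
  shows "\<exists>f k. m \<le> k \<and> orthonormal f {..<k} \<and> (\<forall>i<m. f i = e i) \<and> span (f ` {..<k}) = V"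
proof -
  let ?Q = "\<lambda>k. m \<le> k \<and> (\<exists>f. orthonormal f {..<k} \<and> (\<forall>i<m. f i = e i) \<and> f ` {..<k} \<subseteq> V)"
  obtain B where B: "finite B" "span B = UNIV" using finite_dimensional by blast
  have bound: "k \<le> card B" if "?Q k" for k
  proof -
    from that obtain f where f: "orthonormal f {..<k}" by blast
    have "card (f ` {..<k}) \<le> card B"
      using independent_span_bound[OF B(1) independent_orthonormal(2)[OF f]] B(2) by simp
    then show ?thesis using card_image[OF independent_orthonormal(1)[OF f]] by simp
  qed
  have "?Q m" using e by blast
  have "?Q (Greatest ?Q)" by (rule GreatestI_nat[where b = "card B"]) (fact | rule bound)+
  moreover have "k' \<le> Greatest ?Q" if "?Q k'" for k'
    by (rule Greatest_le_nat[where b = "card B"]) (fact | rule bound)+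
  ultimately obtain k where k: "?Q k" and max: "\<And>k'. ?Q k' \<Longrightarrow> k' \<le> k" by iprover
  from k obtain f where f: "orthonormal f {..<k}" "\<forall>i<m. f i = e i" "f ` {..<k} \<subseteq> V" by blast
  have "V \<subseteq> span (f ` {..<k})"
  proof (rule ccontr)
    assume "\<not> V \<subseteq> span (f ` {..<k})"
    then obtain x where x: "x \<in> V" "x \<notin> span (f ` {..<k})" by blast
    \<comment> \<open>The residual of a missed vector is nonzero and orthogonal to the family;
      normalized, it would make the family longer.\<close>
    let ?y = "x - proj f {..<k} x"
    have "span (f ` {..<k}) \<subseteq> V" by (rule span_minimal[OF f(3) V])
    then have yV: "?y \<in> V" using x(1) proj_in_span[of f "{..<k}" x] subspace_diff[OF V] by blast
    have "?y \<noteq> 0" using x(2) proj_in_span[of f "{..<k}" x] by auto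
    then obtain c where c: "ip (scale c ?y) (scale c ?y) = 1" using ex_normalize by blast
    have orth: "ip (f i) (scale c ?y) = 0" if "i < k" for i
      using ip_proj_left[of f "{..<k}" "f i" x] proj_basis[OF f(1) finite_lessThan, of i] that
      by (simp add: ip_scale_right ip_diff_right)
    then have orth': "ip (scale c ?y) (f i) = 0" if "i < k" for i
      using that by (simp add: ip_conj[of "scale c ?y"] rc_conj_0)
    let ?f = "f(k := scale c ?y)"
    have "orthonormal ?f {..<Suc k}"
      using f(1) c orth orth' by (auto simp: orthonormal_def less_Suc_eq)
    moreover have "\<forall>i<m. ?f i = e i" using f(2) k by auto
    moreover have "?f ` {..<Suc k} \<subseteq> V"
      using f(3) subspace_scale[OF V yV] by (auto simp: less_Suc_eq)
    ultimately have "?Q (Suc k)" using k by (intro conjI exI[of _ ?f]) simp_all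
    then have "Suc k \<le> k" by (rule max)
    then show False by simp
  qed
  then have "span (f ` {..<k}) = V" using span_minimal[OF f(3) V] by blast
  then show ?thesis using f k by blast
qed

lemma ex_orthonormal_basis:
  assumes "subspace V"
  shows "\<exists>e :: nat \<Rightarrow> 'v. orthonormal e {..<dim V} \<and> span (e ` {..<dim V}) = V"
proof -
  have "orthonormal (\<lambda>_. 0) {..<0::nat}" by (simp add: orthonormal_def)
  from orthonormal_extend[OF this _ assms]
  obtain e :: "nat \<Rightarrow> 'v" and k where e: "orthonormal e {..<k}" "span (e ` {..<k}) = V"
    by auto
  have "dim V = k"
    using dim_span_eq_card_independent[OF independent_orthonormal(2)[OF e(1)]]
      card_image[OF independent_orthonormal(1)[OF e(1)]] e(2) by simp
  with e show ?thesis by (intro exI[of _ e]) simp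
qed

lemma span_image_scale:
  assumes "\<And>i. i \<in> A \<Longrightarrow> c i \<noteq> 0"
  shows "span ((\<lambda>i. scale (c i) (w i)) ` A) = span (w ` A)"
proof (rule antisym)
  show "span ((\<lambda>i. scale (c i) (w i)) ` A) \<subseteq> span (w ` A)"
    by (intro span_minimal) (auto intro: span_scale span_base)
  have "w i \<in> span ((\<lambda>i. scale (c i) (w i)) ` A)" if "i \<in> A" for i
  proof -
    have "scale (inverse (c i)) (scale (c i) (w i)) \<in> span ((\<lambda>i. scale (c i) (w i)) ` A)"
      using that by (intro span_scale span_base) auto
    then show ?thesis using assms[OF that] by simp
  qed
  then show "span (w ` A) \<subseteq> span ((\<lambda>i. scale (c i) (w i)) ` A)"
    by (intro span_minimal) auto
qed

section \<open>Sums over coordinate subspaces\<close>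

lemma norm_gram_commute: "norm (gram vs ws) = norm (gram ws vs)"
  by (simp add: gram_conj[of vs] norm_rc_conj)

text \<open>A repeated index repeats a column of the Gram matrix, so its list contributes 0.\<close>

lemma sum_norm_gram_distinct:
  assumes "finite A"
  shows "(\<Sum>K | set K \<subseteq> A \<and> length K = p. (norm (gram vs (map b K)))\<^sup>2) =
    (\<Sum>K | set K \<subseteq> A \<and> length K = p \<and> distinct K. (norm (gram vs (map b K)))\<^sup>2)"
proof (rule sum.mono_neutral_right)
  show "\<forall>K\<in>{K. set K \<subseteq> A \<and> length K = p} - {K. set K \<subseteq> A \<and> length K = p \<and> distinct K}.
      (norm (gram vs (map b K)))\<^sup>2 = 0"
    by (auto simp: gram_not_distinct distinct_map)
qed (use assms in \<open>auto intro: finite_lists_length_eq\<close>)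

lemma sum_angle_coordinate:
  assumes b: "orthonormal b A" "finite A" "span (b ` A) = UNIV"
    and es: "orthonormal_list es" and q: "q \<le> card A"
  shows "(\<Sum>J | J \<subseteq> A \<and> card J = q. (cos (grassmann_angle (span (set es)) (span (b ` J))))\<^sup>2) =
    real ((card A - length es) choose (card A - q))"
proof -
  let ?p = "length es"
  let ?g = "\<lambda>K. (norm (gram es (map b K)))\<^sup>2"
  let ?T = "{J. J \<subseteq> A \<and> card J = q}"
  let ?D = "{K. set K \<subseteq> A \<and> length K = ?p \<and> distinct K}"
  have finD: "finite ?D"
    by (rule finite_subset[OF _ finite_lists_length_eq[OF b(2), of ?p]]) auto
  \<comment> \<open>The condition on \<open>J\<close> is moved from the summation range into the
    summand, so that \<open>K\<close> ranges over a set independent of \<open>J\<close> and the sums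
    can be exchanged.\<close>
  have "(cos (grassmann_angle (span (set es)) (span (b ` J))))\<^sup>2 =
      (\<Sum>K\<in>?D. if set K \<subseteq> J then ?g K else 0) / fact ?p" if J: "J \<in> ?T" for J
  proof -
    have "(\<Sum>K | set K \<subseteq> J \<and> length K = ?p. ?g K) =
        (\<Sum>K | set K \<subseteq> J \<and> length K = ?p \<and> distinct K. ?g K)"
      using J b(2) by (intro sum_norm_gram_distinct) (auto intro: finite_subset[OF _ b(2)])
    also have "{K. set K \<subseteq> J \<and> length K = ?p \<and> distinct K} = {K \<in> ?D. set K \<subseteq> J}"
      using J by auto
    also have "(\<Sum>K\<in>{K \<in> ?D. set K \<subseteq> J}. ?g K) = (\<Sum>K\<in>?D. if set K \<subseteq> J then ?g K else 0)"
      by (rule sum.inter_filter[OF finD])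
    finally show ?thesis using cos_grassmann_angle[OF b _ es, of J] J by simp
  qed
  then have "(\<Sum>J\<in>?T. (cos (grassmann_angle (span (set es)) (span (b ` J))))\<^sup>2) =
      (\<Sum>J\<in>?T. \<Sum>K\<in>?D. if set K \<subseteq> J then ?g K else 0) / fact ?p"
    by (simp add: sum_divide_distrib)
  also have "(\<Sum>J\<in>?T. \<Sum>K\<in>?D. if set K \<subseteq> J then ?g K else 0) =
      (\<Sum>K\<in>?D. real ((card A - ?p) choose (card A - q)) * ?g K)"
  proof (subst sum.swap, rule sum.cong[OF refl])
    fix K assume K: "K \<in> ?D"
    have "(\<Sum>J\<in>?T. if set K \<subseteq> J then ?g K else 0) = (\<Sum>J | J \<in> ?T \<and> set K \<subseteq> J. ?g K)"
      using b(2) by (intro sum.inter_filter[symmetric]) simp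
    also have "{J. J \<in> ?T \<and> set K \<subseteq> J} = {J. J \<subseteq> A \<and> card J = q \<and> set K \<subseteq> J}" by auto
    also have "(\<Sum>J\<in>\<dots>. ?g K) = real ((card A - ?p) choose (card A - q)) * ?g K"
      using K card_supersets[OF b(2) _ q, of "set K"] by (simp add: distinct_card)
    finally show "(\<Sum>J\<in>?T. if set K \<subseteq> J then ?g K else 0) =
        real ((card A - ?p) choose (card A - q)) * ?g K" .
  qed
  \<comment> \<open>The binomial coefficient no longer depends on \<open>K\<close>; the remaining
    sum runs over a full basis and equals \<open>p!\<close>.\<close>
  also have "\<dots> = real ((card A - ?p) choose (card A - q)) * fact ?p"
    using sum_norm_gram_distinct[OF b(2), of es b ?p] sum_norm_gram_basis[OF b es]
    by (simp add: sum_distrib_left[symmetric])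
  finally show ?thesis by simp
qed

lemma sum_coordinate_angle:
  assumes b: "orthonormal b A" "finite A" "span (b ` A) = UNIV"
    and f: "orthonormal f B" "finite B" "span (f ` B) = UNIV" and S: "S \<subseteq> B"
  shows "(\<Sum>J | J \<subseteq> A \<and> card J = q. (cos (grassmann_angle (span (b ` J)) (span (f ` S))))\<^sup>2) =
    real (card S choose q)"
proof -
  let ?h = "\<lambda>J. (cos (grassmann_angle (span (b ` J)) (span (f ` S))))\<^sup>2"
  let ?g = "\<lambda>K L. (norm (gram (map f K) (map b L)))\<^sup>2"
  let ?D = "\<lambda>A. {L. set L \<subseteq> A \<and> length L = q \<and> distinct L}"
  have finS: "finite S" using S f(2) finite_subset by blast
  have h: "?h (set L) = (\<Sum>K\<in>?D S. ?g K L) / fact q" if "L \<in> ?D A" for L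
  proof -
    have "orthonormal_list (map b L)" using that b(1) by (auto intro: orthonormal_list_map)
    from cos_grassmann_angle[OF f S this] that sum_norm_gram_distinct[OF finS, of "map b L" f q]
    show ?thesis by (simp add: norm_gram_commute[of "map b L"])
  qed
  \<comment> \<open>The roles are exchanged: \<open>map f K\<close> is now the orthonormal list and
    \<open>b\<close> the full basis to which Parseval applies.\<close>
  have total: "(\<Sum>L\<in>?D A. ?g K L) = fact q" if "K \<in> ?D S" for K
  proof -
    have "orthonormal_list (map f K)" using that f(1) S by (auto intro: orthonormal_list_map)
    from sum_norm_gram_basis[OF b this] that show ?thesis
      by (simp add: sum_norm_gram_distinct[OF b(2)])
  qed
  have card: "real (card (?D S)) = fact q * real (card S choose q)"
    using sum_distinct_lists[OF finS, of "\<lambda>_. 1" q] n_subsets[OF finS] by simp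
  \<comment> \<open>Passing from sets to lists brings in \<open>q!\<close> on the left; the count of
    lists in \<open>S\<close> brings in the same factor on the right.\<close>
  have "fact q * (\<Sum>J | J \<subseteq> A \<and> card J = q. ?h J) = (\<Sum>L\<in>?D A. ?h (set L))"
    by (rule sum_distinct_lists[OF b(2), symmetric])
  also have "\<dots> = (\<Sum>L\<in>?D A. \<Sum>K\<in>?D S. ?g K L) / fact q"
    using h by (simp add: sum_divide_distrib)
  also have "(\<Sum>L\<in>?D A. \<Sum>K\<in>?D S. ?g K L) = (\<Sum>K\<in>?D S. fact q)"
    by (subst sum.swap) (simp add: total)
  also have "\<dots> / fact q = fact q * real (card S choose q)"
    using card by simp
  finally show ?thesis by simp
qed

end

theorem theorem4p7:
  fixes scale :: "'k::rc_field \<Rightarrow> 'v::ab_group_add \<Rightarrow> 'v"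
    and ip :: "'v \<Rightarrow> 'v \<Rightarrow> 'k"
    and V :: "'v set"
    and w :: "nat \<Rightarrow> 'v"
    and n p q :: nat
  assumes "inner_product_space scale ip"
    and "vector_space.dim scale (UNIV :: 'v set) = n"
    and "module.subspace scale V"
    and "vector_space.dim scale V = p"
    and "q \<le> n"
    and "inner_product_space.orthogonal_basis scale ip n w"
  shows "(p \<le> q \<longrightarrow>
      (\<Sum>I\<in>multi_indices n q.
         (cos (inner_product_space.grassmann_angle scale ip
                 V (inner_product_space.coordinate_subspace scale w I)))\<^sup>2)
      = real ((n - p) choose (n - q)))
    \<and> (q < p \<longrightarrow>
      (\<Sum>I\<in>multi_indices n q.
         (cos (inner_product_space.grassmann_angle scale ip
                 (inner_product_space.coordinate_subspace scale w I) V))\<^sup>2)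
      = real (p choose q))"
proof -
  interpret inner_product_space scale ip by fact
  have w: "independent (w ` {1..n})" "span (w ` {1..n}) = UNIV"
    and orth: "\<And>i j. i \<in> {1..n} \<Longrightarrow> j \<in> {1..n} \<Longrightarrow> i \<noteq> j \<Longrightarrow> ip (w i) (w j) = 0"
    using assms(6) by (auto simp: orthogonal_basis_def)
  \<comment> \<open>The given basis is only orthogonal; scaling its vectors to unit length leaves
    all coordinate subspaces unchanged.\<close>
  have "\<forall>i\<in>{1..n}. \<exists>c. c \<noteq> 0 \<and> ip (scale c (w i)) (scale c (w i)) = 1"
  proof
    fix i assume "i \<in> {1..n}"
    then have "w i \<noteq> 0" using w(1) dependent_zero by force
    then show "\<exists>c. c \<noteq> 0 \<and> ip (scale c (w i)) (scale c (w i)) = 1" by (rule ex_normalize)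
  qed
  then obtain c where c: "\<And>i. i \<in> {1..n} \<Longrightarrow> c i \<noteq> 0 \<and> ip (scale (c i) (w i)) (scale (c i) (w i)) = 1"
    by metis
  define b where "b = (\<lambda>i. scale (c i) (w i))"
  have span_b: "span (b ` J) = span (w ` J)" if "J \<subseteq> {1..n}" for J
    unfolding b_def using that c by (intro span_image_scale) auto
  have b: "orthonormal b {1..n}" "finite {1..n}" "span (b ` {1..n}) = UNIV"
    using c orth span_b[of "{1..n}"] w(2)
    by (auto simp: orthonormal_def b_def ip_scale_left ip_scale_right)
  obtain e where e: "orthonormal e {..<p}" "span (e ` {..<p}) = V"
    using ex_orthonormal_basis[OF assms(3)] assms(4) by auto
  \<comment> \<open>For (ii) \<open>V\<close> is the target of the projection, so its basis has to
    be the initial part of an orthonormal basis of the whole space.\<close>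
  obtain f k where f: "p \<le> k" "orthonormal f {..<k}" "\<forall>i<p. f i = e i" "span (f ` {..<k}) = UNIV"
    using orthonormal_extend[OF e(1) subset_UNIV subspace_UNIV] by blast
  have es: "orthonormal_list (map e [0..<p])" "span (set (map e [0..<p])) = V"
    using orthonormal_list_map[OF e(1), of "[0..<p]"] e(2) by (auto simp: atLeast0LessThan)
  have "f ` {..<p} = e ` {..<p}" using f(3) by (intro image_cong) auto
  with e(2) have V: "span (f ` {..<p}) = V" by simp
  have "(\<Sum>I\<in>multi_indices n q. (cos (grassmann_angle V (coordinate_subspace w I)))\<^sup>2) =
      (\<Sum>J | J \<subseteq> {1..n} \<and> card J = q. (cos (grassmann_angle V (span (b ` J))))\<^sup>2)"
    using span_b sum_multi_indices[of "\<lambda>J. (cos (grassmann_angle V (span (w ` J))))\<^sup>2" n q]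
    by (simp add: coordinate_subspace_def)
  also have "\<dots> = real ((n - p) choose (n - q))"
    using sum_angle_coordinate[OF b es(1), of q] \<open>q \<le> n\<close> es(2) by simp
  finally have i: "(\<Sum>I\<in>multi_indices n q. (cos (grassmann_angle V (coordinate_subspace w I)))\<^sup>2) =
      real ((n - p) choose (n - q))" .
  have "(\<Sum>I\<in>multi_indices n q. (cos (grassmann_angle (coordinate_subspace w I) V))\<^sup>2) =
      (\<Sum>J | J \<subseteq> {1..n} \<and> card J = q. (cos (grassmann_angle (span (b ` J)) V))\<^sup>2)"
    using span_b sum_multi_indices[of "\<lambda>J. (cos (grassmann_angle (span (w ` J)) V))\<^sup>2" n q]
    by (simp add: coordinate_subspace_def)
  also have "\<dots> = real (p choose q)"
    using sum_coordinate_angle[OF b f(2) finite_lessThan f(4), of "{..<p}" q] V f(1) by simp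
  finally show ?thesis using i by blast
qed

end
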